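(* Let $(G,X)$ be a minimal distal flow with $G$ compactly generated. If $X$ is not connected, then $(G,X)$ has a non-trivial regularly almost periodic factor.
   Context: A Hausdorff para-topological group is a group with a Hausdorff topology for which multiplication $G\times G\to G$ is jointly continuous (inversion need not be continuous). A flow $(G,X)$ consists of a Hausdorff para-topological group $G$, a locally compact Hausdorff uniform space $X$, and a jointly continuous map $G\times X\to X$, $(t,x)\mapsto tx$, with $ex=x$ and $(st)x=s(tx)$, such that $\overline{Gx}$ is compact for every $x\in X$. It is minimal if $\overline{Gx}=X$ for all $x\in X$ (hence $X$ is compact). $G$ is compactly generated if there is a compact $\Gamma\subseteq G$ with $e\in\Gamma=\Gamma^{-1}$ and $G=\bigcup_{r\ge1}\Gamma^r$. $(G,X)$ is distal if for all $x\ne y$ in $X$ the closure of $\{(gx,gy):g\in G\}$ in $X\times X$ is disjoint from the diagonal. A factor of $(G,X)$ is a flow $(G,Y)$ together with a continuous $G$-equivariant surjection $X\to Y$; it is non-trivial if $Y$ is not a singleton. $A\subseteq G$ is syndetic if $G=K^{-1}A$ for some compact $K\subseteq G$. A flow $(G,Y)$ is regularly almost periodic if for every index $\alpha$ of the uniformity of $Y$ there is a syndetic normal subgroup $A$ of $G$ with $Ay\subseteq\alpha[y]$ for all $y\in Y$, where $\alpha[y]=\{z:(y,z)\in\alpha\}$. *)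

theory Defs
  imports "HOL-Analysis.Analysis" "HOL-Algebra.Coset"
begin

text \<open>
  All spaces live on carrier sets, because the factor in the theorem is quantified existentially
  and HOL cannot quantify over types. A factor of a flow on \<open>X :: 'x set\<close> is isomorphic to one whose
  points are the fibres of the factor map, so carriers of type \<open>'x set set\<close> cover all factors.
  The type class \<open>uniform_space\<close> is accordingly replaced by a carrier-based version; the indices
  of a uniformity on \<open>X\<close> are its entourages, as subsets of \<open>X \<times> X\<close>.
\<close>

definition is_uniformity :: "'a set \<Rightarrow> ('a \<times> 'a) set set \<Rightarrow> bool" where
  "is_uniformity X \<U> \<longleftrightarrow>
     \<U> \<noteq> {} \<and>
     (\<forall>\<alpha>\<in>\<U>. Id_on X \<subseteq> \<alpha> \<and> \<alpha> \<subseteq> X \<times> X) \<and>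
     (\<forall>\<alpha>\<in>\<U>. \<forall>\<beta>. \<alpha> \<subseteq> \<beta> \<and> \<beta> \<subseteq> X \<times> X \<longrightarrow> \<beta> \<in> \<U>) \<and>
     (\<forall>\<alpha>\<in>\<U>. \<forall>\<beta>\<in>\<U>. \<alpha> \<inter> \<beta> \<in> \<U>) \<and>
     (\<forall>\<alpha>\<in>\<U>. \<alpha>\<inverse> \<in> \<U>) \<and>
     (\<forall>\<alpha>\<in>\<U>. \<exists>\<beta>\<in>\<U>. \<beta> O \<beta> \<subseteq> \<alpha>)"

text \<open>The set \<open>\<alpha>[x]\<close> is the relational image \<open>\<alpha> `` {x}\<close>.\<close>

definition unif_topology :: "'a set \<Rightarrow> ('a \<times> 'a) set set \<Rightarrow> 'a topology" where
  "unif_topology X \<U> = topology (\<lambda>S. S \<subseteq> X \<and> (\<forall>x\<in>S. \<exists>\<alpha>\<in>\<U>. \<alpha> `` {x} \<subseteq> S))"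

lemma openin_unif_topology:
  assumes "is_uniformity X \<U>"
  shows "openin (unif_topology X \<U>) S \<longleftrightarrow> S \<subseteq> X \<and> (\<forall>x\<in>S. \<exists>\<alpha>\<in>\<U>. \<alpha> `` {x} \<subseteq> S)"
proof -
  have "istopology (\<lambda>S. S \<subseteq> X \<and> (\<forall>x\<in>S. \<exists>\<alpha>\<in>\<U>. \<alpha> `` {x} \<subseteq> S))"
    unfolding istopology_def
  proof (intro conjI allI impI)
    fix S T
    assume S: "S \<subseteq> X \<and> (\<forall>x\<in>S. \<exists>\<alpha>\<in>\<U>. \<alpha> `` {x} \<subseteq> S)"
      and T: "T \<subseteq> X \<and> (\<forall>x\<in>T. \<exists>\<alpha>\<in>\<U>. \<alpha> `` {x} \<subseteq> T)"
    show "S \<inter> T \<subseteq> X" using S by blast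
    show "\<forall>x\<in>S \<inter> T. \<exists>\<alpha>\<in>\<U>. \<alpha> `` {x} \<subseteq> S \<inter> T"
    proof
      fix x assume "x \<in> S \<inter> T"
      then obtain \<alpha> \<beta> where "\<alpha> \<in> \<U>" "\<beta> \<in> \<U>" "\<alpha> `` {x} \<subseteq> S" "\<beta> `` {x} \<subseteq> T"
        using S T by (meson IntD1 IntD2)
      moreover from \<open>\<alpha> \<in> \<U>\<close> \<open>\<beta> \<in> \<U>\<close> have "\<alpha> \<inter> \<beta> \<in> \<U>"
        using assms[unfolded is_uniformity_def, THEN conjunct2, THEN conjunct2, THEN conjunct2, THEN conjunct1]
        by blast
      moreover have "(\<alpha> \<inter> \<beta>) `` {x} \<subseteq> S \<inter> T"
        using \<open>\<alpha> `` {x} \<subseteq> S\<close> \<open>\<beta> `` {x} \<subseteq> T\<close> by blast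
      ultimately show "\<exists>\<alpha>\<in>\<U>. \<alpha> `` {x} \<subseteq> S \<inter> T" by (meson bexI)
    qed
  next
    fix \<K>
    assume K: "\<forall>S\<in>\<K>. S \<subseteq> X \<and> (\<forall>x\<in>S. \<exists>\<alpha>\<in>\<U>. \<alpha> `` {x} \<subseteq> S)"
    show "\<Union>\<K> \<subseteq> X" using K by (simp add: Sup_le_iff)
    show "\<forall>x\<in>\<Union>\<K>. \<exists>\<alpha>\<in>\<U>. \<alpha> `` {x} \<subseteq> \<Union>\<K>"
    proof
      fix x assume "x \<in> \<Union>\<K>"
      then obtain S where "S \<in> \<K>" "x \<in> S" by (rule UnionE)
      moreover from this obtain \<alpha> where "\<alpha> \<in> \<U>" "\<alpha> `` {x} \<subseteq> S" using K by meson
      ultimately show "\<exists>\<alpha>\<in>\<U>. \<alpha> `` {x} \<subseteq> \<Union>\<K>" by (meson Union_upper order_trans)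
    qed
  qed
  then show ?thesis by (simp add: unif_topology_def)
qed

lemma topspace_unif_topology:
  assumes "is_uniformity X \<U>"
  shows "topspace (unif_topology X \<U>) = X"
proof
  show "topspace (unif_topology X \<U>) \<subseteq> X"
    using openin_topspace[of "unif_topology X \<U>"] openin_unif_topology[OF assms] by blast
  obtain \<alpha> where "\<alpha> \<in> \<U>"
    using assms[unfolded is_uniformity_def, THEN conjunct1] by blast
  moreover from \<open>\<alpha> \<in> \<U>\<close> have "\<alpha> \<subseteq> X \<times> X"
    using assms[unfolded is_uniformity_def, THEN conjunct2, THEN conjunct1] by blast
  ultimately have "\<forall>x\<in>X. \<exists>\<alpha>\<in>\<U>. \<alpha> `` {x} \<subseteq> X" by blast
  then have "openin (unif_topology X \<U>) X"
    by (simp add: openin_unif_topology[OF assms])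
  then show "X \<subseteq> topspace (unif_topology X \<U>)" by (rule openin_subset)
qed

locale para_topological_group = group G for G (structure) +
  fixes T :: "'g topology"
  assumes topspace_group: "topspace T = carrier G"
    and Hausdorff_group: "Hausdorff_space T"
    and continuous_mult: "continuous_map (prod_topology T T) T (\<lambda>(s, t). s \<otimes> t)"

locale flow = para_topological_group G T for G (structure) and T :: "'g topology" +
  fixes X :: "'x set" and \<U> :: "('x \<times> 'x) set set" and act :: "'g \<Rightarrow> 'x \<Rightarrow> 'x"
  assumes uniformity: "is_uniformity X \<U>"
    and Hausdorff: "Hausdorff_space (unif_topology X \<U>)"
    and locally_compact: "locally_compact_space (unif_topology X \<U>)"
    and continuous_act:
      "continuous_map (prod_topology T (unif_topology X \<U>)) (unif_topology X \<U>) (\<lambda>(t, x). act t x)"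
    and act_one: "x \<in> X \<Longrightarrow> act \<one> x = x"
    and act_mult: "\<lbrakk>s \<in> carrier G; t \<in> carrier G; x \<in> X\<rbrakk> \<Longrightarrow> act (s \<otimes> t) x = act s (act t x)"
    and compact_orbit_closure:
      "x \<in> X \<Longrightarrow> compactin (unif_topology X \<U>)
         (unif_topology X \<U> closure_of ((\<lambda>g. act g x) ` carrier G))"
begin

definition minimal :: bool where
  "minimal \<longleftrightarrow> (\<forall>x\<in>X. unif_topology X \<U> closure_of ((\<lambda>g. act g x) ` carrier G) = X)"

definition distal :: bool where
  "distal \<longleftrightarrow> (\<forall>x\<in>X. \<forall>y\<in>X. x \<noteq> y \<longrightarrow>
     (prod_topology (unif_topology X \<U>) (unif_topology X \<U>)
        closure_of ((\<lambda>g. (act g x, act g y)) ` carrier G)) \<inter> Id_on X = {})"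

end

text \<open>\<open>\<Gamma>\<^sup>r\<close> is the \<open>r\<close>-fold product set, with \<open>\<Gamma>\<^sup>0 = {\<one>}\<close>.\<close>

definition (in para_topological_group) compactly_generated :: bool where
  "compactly_generated \<longleftrightarrow>
     (\<exists>\<Gamma>. compactin T \<Gamma> \<and> \<one> \<in> \<Gamma> \<and> \<Gamma> = set_inv \<Gamma> \<and>
          carrier G = (\<Union>r\<in>{1..}. (((<#>) \<Gamma>) ^^ r) {\<one>}))"

definition (in para_topological_group) syndetic :: "'g set \<Rightarrow> bool" where
  "syndetic A \<longleftrightarrow> A \<subseteq> carrier G \<and> (\<exists>K. compactin T K \<and> carrier G = set_inv K <#> A)"

definition (in flow) regularly_almost_periodic :: bool where
  "regularly_almost_periodic \<longleftrightarrow>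
     (\<forall>\<alpha>\<in>\<U>. \<exists>A. syndetic A \<and> A \<lhd> G \<and> (\<forall>y\<in>X. (\<lambda>a. act a y) ` A \<subseteq> \<alpha> `` {y}))"

text \<open>\<open>flow_factor G T X \<U> act Y \<V> act' \<phi>\<close>: the flow \<open>(G,Y)\<close> together with \<open>\<phi>\<close> is a factor of
  the flow \<open>(G,X)\<close>.\<close>

locale flow_factor =
  X: flow G T X \<U> act + Y: flow G T Y \<V> act'
  for G (structure) and T :: "'g topology"
    and X :: "'x set" and \<U> and act and Y :: "'y set" and \<V> and act' +
  fixes \<phi> :: "'x \<Rightarrow> 'y"
  assumes continuous_factor: "continuous_map (unif_topology X \<U>) (unif_topology Y \<V>) \<phi>"
    and surj_factor: "\<phi> ` X = Y"
    and equivariant: "\<lbrakk>g \<in> carrier G; x \<in> X\<rbrakk> \<Longrightarrow> \<phi> (act g x) = act' g (\<phi> x)"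

end

theory Submission
  imports Defs
begin

text \<open>
  Let \<open>U\<close> be a proper non-empty clopen subset of the compact space \<open>X\<close> and \<open>\<Gamma>\<close> a compact symmetric
  generating set. Call \<open>x\<close> and \<open>y\<close> \<open>n\<close>-equivalent if \<open>gx \<in> U \<longleftrightarrow> gy \<in> U\<close> for all \<open>g \<in> \<Gamma>\<^sup>n\<close>.
  By compactness only finitely many sets \<open>g\<inverse>U\<close> with \<open>g \<in> \<Gamma>\<^sup>n\<close> occur, so this relation is clopen
  with finitely many classes.

  If these relations do not stabilise, choose pairs that are \<open>n\<close>-equivalent but separated by some word
  of length \<open>n + 1\<close>, and move them by that word. A limit \<open>(a, b)\<close> of the moved pairs is separated by
  \<open>U\<close>, while for every \<open>j\<close> some translate of it is \<open>j\<close>-equivalent (undo a prefix of length \<open>j + 1\<close> of the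
  separating word). Some element \<open>p\<close> of the Ellis semigroup therefore maps \<open>(a, b)\<close> to a pair that is
  \<open>n\<close>-equivalent for all \<open>n\<close>. In a distal flow \<open>p\<close> has a left inverse in the Ellis semigroup, and it
  carries this pair back to \<open>(a, b)\<close> within the closed set of pairs not separated by \<open>U\<close>, a contradiction.

  Once stable, the relation is \<open>G\<close>-invariant, so \<open>G\<close> permutes its finitely many classes. They form a
  non-trivial factor, on which the kernel of the permutation action is normal, has finite index and
  acts trivially.
\<close>

section \<open>The Ellis semigroup of a distal flow\<close>

lemma finite_Inter_chain:
  assumes "finite \<F>" "\<F> \<noteq> {}" "\<And>C D. \<lbrakk>C \<in> \<F>; D \<in> \<F>\<rbrakk> \<Longrightarrow> C \<subseteq> D \<or> D \<subseteq> C"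
  shows "\<Inter>\<F> \<in> \<F>"
  using assms
proof (induction rule: finite_ne_induct)
  case (insert C \<F>)
  then have "\<Inter>\<F> \<in> \<F>" by blast
  with insert.prems[of C "\<Inter>\<F>"] show ?case by (auto simp: inf.absorb1 inf.absorb2)
qed simp

text \<open>Compactness and Zorn give a minimal closed subsemigroup \<open>A\<close>. For
  \<open>u\<close> in \<open>A\<close>, minimality makes the right translate of \<open>A\<close> by
  \<open>u\<close> all of \<open>A\<close>, so some \<open>v\<close> satisfies
  \<open>f v u = u\<close>; minimality then forces the closed subsemigroup of all such
  \<open>v\<close> to be \<open>A\<close>, and \<open>A\<close> contains \<open>u\<close>.\<close>

lemma Ellis_Numakura:
  fixes T :: "'a topology" and f :: "'a \<Rightarrow> 'a \<Rightarrow> 'a"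
  assumes compact: "compact_space T" and Hausdorff: "Hausdorff_space T"
    and nonempty: "topspace T \<noteq> {}"
    and closed: "\<And>x y. \<lbrakk>x \<in> topspace T; y \<in> topspace T\<rbrakk> \<Longrightarrow> f x y \<in> topspace T"
    and assoc: "\<And>x y z. \<lbrakk>x \<in> topspace T; y \<in> topspace T; z \<in> topspace T\<rbrakk> \<Longrightarrow> f (f x y) z = f x (f y z)"
    and cont: "\<And>y. y \<in> topspace T \<Longrightarrow> continuous_map T T (\<lambda>x. f x y)"
  obtains u where "u \<in> topspace T" "f u u = u"
proof -
  define good where "good A \<longleftrightarrow> closedin T A \<and> A \<noteq> {} \<and> (\<forall>x\<in>A. \<forall>y\<in>A. f x y \<in> A)" for A
  \<comment> \<open>Zorn yields maximal elements here, so a minimal \<open>good\<close> set is found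
    as the complement of a maximal member of \<open>\<S>\<close>.\<close>
  define \<S> where "\<S> = {B. B \<subseteq> topspace T \<and> good (topspace T - B)}"
  have "\<exists>M\<in>\<S>. \<forall>B\<in>\<S>. M \<subseteq> B \<longrightarrow> B = M"
  proof (rule subset_Zorn_nonempty)
    have "good (topspace T)" using nonempty closed by (auto simp: good_def)
    then show "\<S> \<noteq> {}" unfolding \<S>_def by (metis (mono_tags, lifting) Diff_empty empty_iff empty_subsetI mem_Collect_eq)
  next
    fix \<C> assume \<C>: "\<C> \<noteq> {}" "subset.chain \<S> \<C>"
    have sub: "\<C> \<subseteq> \<S>" and lin: "\<And>A B. \<lbrakk>A \<in> \<C>; B \<in> \<C>\<rbrakk> \<Longrightarrow> A \<subseteq> B \<or> B \<subseteq> A"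
      using \<C>(2) unfolding subset_chain_def by blast+
    let ?\<D> = "(\<lambda>B. topspace T - B) ` \<C>"
    have D: "good D" if "D \<in> ?\<D>" for D using that sub by (auto simp: \<S>_def)
    \<comment> \<open>A finite non-empty subfamily of a chain contains its own intersection, so the
      finite intersection property holds and compactness applies.\<close>
    have "\<Inter>?\<D> \<noteq> {}"
    proof (rule compact_space_fip[THEN iffD1, OF compact, rule_format], intro conjI ballI allI impI)
      show "closedin T D" if "D \<in> ?\<D>" for D using D[OF that] by (simp add: good_def)
      fix \<F> assume \<F>: "finite \<F> \<and> \<F> \<subseteq> ?\<D>"
      show "\<Inter>\<F> \<noteq> {}"
      proof (cases "\<F> = {}")
        case False
        have chain: "C \<subseteq> D \<or> D \<subseteq> C" if "C \<in> \<F>" "D \<in> \<F>" for C D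
          using that \<F> lin by blast
        have "\<Inter>\<F> \<in> \<F>"
          using \<F> False chain by (intro finite_Inter_chain) auto
        then show ?thesis using \<F> D unfolding good_def by blast
      qed simp
    qed
    moreover have "closedin T (\<Inter>?\<D>)"
      using \<C>(1) D by (intro closedin_Inter) (auto simp: good_def)
    moreover have "f x y \<in> \<Inter>?\<D>" if "x \<in> \<Inter>?\<D>" "y \<in> \<Inter>?\<D>" for x y
      using that D unfolding good_def by blast
    ultimately have "good (\<Inter>?\<D>)" by (simp only: good_def) simp
    moreover have "\<Inter>?\<D> = topspace T - \<Union>\<C>" using \<C>(1) by auto
    moreover have "\<Union>\<C> \<subseteq> topspace T" using sub by (auto simp: \<S>_def)
    ultimately show "\<Union>\<C> \<in> \<S>" by (simp add: \<S>_def)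
  qed
  then obtain M where M: "M \<in> \<S>" and Mmax: "\<And>B. \<lbrakk>B \<in> \<S>; M \<subseteq> B\<rbrakk> \<Longrightarrow> B = M" by blast
  define A where "A = topspace T - M"
  have A: "good A" using M by (simp add: \<S>_def A_def)
  have Asub: "A \<subseteq> topspace T" by (auto simp: A_def)
  have min: "B = A" if "good B" "B \<subseteq> A" for B
  proof -
    have "topspace T - (topspace T - B) = B" using that Asub by blast
    then have "topspace T - B \<in> \<S>" using that by (simp add: \<S>_def)
    moreover have "M \<subseteq> topspace T - B" using that M by (auto simp: A_def \<S>_def)
    ultimately have "topspace T - B = M" by (rule Mmax)
    then show ?thesis using that Asub by (auto simp: A_def)
  qed
  obtain u where u: "u \<in> A" using A by (auto simp: good_def)
  have uT: "u \<in> topspace T" using u Asub by blast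
  have mul: "\<And>x y. \<lbrakk>x \<in> A; y \<in> A\<rbrakk> \<Longrightarrow> f x y \<in> A" using A by (auto simp: good_def)
  have clA: "closedin T A" using A by (simp add: good_def)
  have "(\<lambda>x. f x u) ` A = A"
  proof (rule min)
    \<comment> \<open>Continuity of right translation makes the image compact; the Hausdorff
      property then makes it closed.\<close>
    have "compactin T ((\<lambda>x. f x u) ` A)"
      by (rule image_compactin[OF closedin_compact_space[OF compact clA] cont[OF uT]])
    then have "closedin T ((\<lambda>x. f x u) ` A)" by (rule compactin_imp_closedin[OF Hausdorff])
    moreover have "f (f x u) (f y u) \<in> (\<lambda>x. f x u) ` A" if "x \<in> A" "y \<in> A" for x y
    proof -
      have "f (f x u) (f y u) = f (f (f x u) y) u"
        using that u Asub closed by (subst assoc[of "f x u" y u]) auto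
      then show ?thesis using that u mul by blast
    qed
    ultimately show "good ((\<lambda>x. f x u) ` A)" using u by (auto simp: good_def)
    show "(\<lambda>x. f x u) ` A \<subseteq> A" using mul u by blast
  qed
  then obtain v where v: "v \<in> A" "f v u = u" using u by (metis (no_types, lifting) imageE)
  have "{x \<in> A. f x u = u} = A"
  proof (rule min)
    have "closedin T {x \<in> topspace T. f x u \<in> {u}}"
      by (rule closedin_continuous_map_preimage[OF cont[OF uT]]) (simp add: uT Hausdorff closedin_Hausdorff_sing_eq)
    then have "closedin T (A \<inter> {x \<in> topspace T. f x u \<in> {u}})" by (rule closedin_Int[OF clA])
    moreover have "A \<inter> {x \<in> topspace T. f x u \<in> {u}} = {x \<in> A. f x u = u}" using Asub by blast
    moreover have "f (f x y) u = u" if "x \<in> A" "y \<in> A" "f x u = u" "f y u = u" for x y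
      using that Asub uT by (subst assoc) auto
    ultimately show "good {x \<in> A. f x u = u}" using v mul by (auto simp: good_def)
  qed auto
  then have "f u u = u" using u by blast
  then show thesis using that uT by blast
qed

section \<open>The closure of the translations under pointwise convergence\<close>

context flow
begin

abbreviation top_X :: "'x topology" where
  "top_X \<equiv> unif_topology X \<U>"

lemma topspace_X: "topspace top_X = X"
  by (rule topspace_unif_topology[OF uniformity])

lemma act_closed: "act g x \<in> X" if "g \<in> carrier G" "x \<in> X"
  using funcset_mem[OF continuous_map_funspace[OF continuous_act], of "(g, x)"] that
  by (simp add: topspace_X topspace_group)

lemma act_inv: "act (inv g) (act g x) = x" "act g (act (inv g) x) = x"
  if "g \<in> carrier G" "x \<in> X"
  using that act_mult[of "inv g" g x] act_mult[of g "inv g" x] by (simp_all add: act_one)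

lemma continuous_act_fixed: "continuous_map top_X top_X (act g)" if "g \<in> carrier G"
proof -
  have "continuous_map top_X (prod_topology T top_X) (\<lambda>x. (g, x))"
    using that by (simp add: continuous_map_pairwise o_def topspace_group)
  from continuous_map_compose[OF this continuous_act] show ?thesis by (simp add: o_def)
qed

lemma continuous_orbit_map: "continuous_map T top_X (\<lambda>g. act g x)" if "x \<in> X"
proof -
  have "continuous_map T (prod_topology T top_X) (\<lambda>g. (g, x))"
    using that by (simp add: continuous_map_pairwise o_def topspace_X)
  from continuous_map_compose[OF this continuous_act] show ?thesis by (simp add: o_def)
qed

abbreviation top_maps :: "('x \<Rightarrow> 'x) topology" where
  "top_maps \<equiv> product_topology (\<lambda>_. top_X) X"

text \<open>Points of \<open>top_maps\<close> are extensional functions, hence the restriction of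
  each translation to \<open>X\<close>.\<close>

definition Ellis_semigroup :: "('x \<Rightarrow> 'x) set" where
  "Ellis_semigroup = top_maps closure_of ((\<lambda>g. restrict (act g) X) ` carrier G)"

lemma translations_subset: "(\<lambda>g. restrict (act g) X) ` carrier G \<subseteq> topspace top_maps"
  by (auto simp: topspace_X act_closed)

lemma Ellis_semigroup_subset: "Ellis_semigroup \<subseteq> topspace top_maps"
  unfolding Ellis_semigroup_def by (rule closure_of_subset_topspace)

lemma Ellis_semigroup_maps: "p x \<in> X" if "p \<in> Ellis_semigroup" "x \<in> X"
  using that Ellis_semigroup_subset by (auto simp: topspace_X)

lemma translation_in_Ellis: "restrict (act g) X \<in> Ellis_semigroup" if "g \<in> carrier G"
  unfolding Ellis_semigroup_def using closure_of_subset[OF translations_subset] that by blast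

lemma continuous_eval: "continuous_map top_maps top_X (\<lambda>p. p x)" if "x \<in> X"
  using that by (rule continuous_map_product_projection)

lemma continuous_eval_pair:
  "continuous_map top_maps (prod_topology top_X top_X) (\<lambda>p. (p x, p y))" if "x \<in> X" "y \<in> X"
  using that by (intro continuous_map_pairedI continuous_eval)

text \<open>At \<open>x\<close> the composite is the evaluation of \<open>p\<close> at
  \<open>q x\<close>, so continuity in \<open>p\<close> holds even when \<open>q\<close> is
  discontinuous.\<close>

lemma continuous_compose_left:
  assumes "q \<in> topspace top_maps"
  shows "continuous_map top_maps top_maps (\<lambda>p. compose X p q)"
proof -
  have "continuous_map top_maps top_X (\<lambda>p. compose X p q x)" if "x \<in> X" for x
    using assms that by (auto simp: compose_def topspace_X PiE_iff intro!: continuous_eval)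
  then show ?thesis by (auto simp: continuous_map_componentwise compose_def)
qed

text \<open>Continuity in the right factor relies on the left factor being a continuous map, which
  translations are but their pointwise limits may fail to be.\<close>

lemma continuous_compose_translation:
  assumes "g \<in> carrier G"
  shows "continuous_map top_maps top_maps (\<lambda>p. compose X (restrict (act g) X) p)"
proof -
  have "continuous_map top_maps top_X (\<lambda>p. compose X (restrict (act g) X) p x)" if x: "x \<in> X" for x
  proof (rule continuous_map_eq)
    show "continuous_map top_maps top_X (act g \<circ> (\<lambda>p. p x))"
      by (rule continuous_map_compose[OF continuous_eval[OF x] continuous_act_fixed[OF assms]])
  next
    fix p assume "p \<in> topspace top_maps"
    then show "(act g \<circ> (\<lambda>p. p x)) p = compose X (restrict (act g) X) p x"
      using x by (auto simp: compose_def topspace_X PiE_iff)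
  qed
  then show ?thesis by (auto simp: continuous_map_componentwise compose_def)
qed

lemma closedin_Ellis_semigroup: "closedin top_maps Ellis_semigroup"
  by (simp add: Ellis_semigroup_def)

text \<open>The two limits are taken one after the other: first the right factor, with a translation
  on the left, then the left factor, with the limit \<open>q\<close> fixed on the right. Each
  passage uses one of the two one-sided continuities.\<close>

lemma Ellis_semigroup_compose:
  assumes "p \<in> Ellis_semigroup" "q \<in> Ellis_semigroup"
  shows "compose X p q \<in> Ellis_semigroup"
proof -
  let ?\<rho> = "\<lambda>g. restrict (act g) X"
  have translate: "compose X (?\<rho> g) q \<in> Ellis_semigroup" if g: "g \<in> carrier G" for g
  proof -
    have "compose X (?\<rho> g) ` (?\<rho> ` carrier G) \<subseteq> ?\<rho> ` carrier G"
    proof clarify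
      fix h assume h: "h \<in> carrier G"
      have "compose X (?\<rho> g) (?\<rho> h) = ?\<rho> (g \<otimes> h)"
        using g h by (auto simp: compose_def act_mult act_closed)
      then show "compose X (?\<rho> g) (?\<rho> h) \<in> ?\<rho> ` carrier G" using g h by blast
    qed
    then have "top_maps closure_of (compose X (?\<rho> g) ` (?\<rho> ` carrier G)) \<subseteq> Ellis_semigroup"
      unfolding Ellis_semigroup_def by (rule closure_of_mono)
    moreover have "compose X (?\<rho> g) q \<in> top_maps closure_of (compose X (?\<rho> g) ` (?\<rho> ` carrier G))"
      using continuous_map_image_closure_subset[OF continuous_compose_translation[OF g], of "?\<rho> ` carrier G"]
        assms(2) unfolding Ellis_semigroup_def by blast
    ultimately show ?thesis by blast
  qed
  have q: "q \<in> topspace top_maps" using assms(2) Ellis_semigroup_subset by blast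
  have "compose X p q \<in> top_maps closure_of ((\<lambda>p. compose X p q) ` (?\<rho> ` carrier G))"
    using continuous_map_image_closure_subset[OF continuous_compose_left[OF q], of "?\<rho> ` carrier G"]
      assms(1) unfolding Ellis_semigroup_def by blast
  moreover have "top_maps closure_of ((\<lambda>p. compose X p q) ` (?\<rho> ` carrier G)) \<subseteq> Ellis_semigroup"
    using translate by (intro closure_of_minimal[OF _ closedin_Ellis_semigroup]) blast
  ultimately show ?thesis by blast
qed

text \<open>This translates membership in the semigroup into orbit closures of pairs, the form in
  which distality is stated.\<close>

lemma Ellis_semigroup_orbit_closure:
  assumes "p \<in> Ellis_semigroup" "x \<in> X" "y \<in> X"
  shows "(p x, p y) \<in> prod_topology top_X top_X closure_of ((\<lambda>g. (act g x, act g y)) ` carrier G)"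
proof -
  have eq: "(\<lambda>p. (p x, p y)) ` (\<lambda>g. restrict (act g) X) ` carrier G = (\<lambda>g. (act g x, act g y)) ` carrier G"
    using assms by (simp add: image_image)
  show ?thesis
    using continuous_map_image_closure_subset[OF continuous_eval_pair[OF assms(2,3)],
        of "(\<lambda>g. restrict (act g) X) ` carrier G"] assms(1)
    unfolding eq Ellis_semigroup_def by blast
qed

text \<open>The left ideal of all \<open>compose X q p\<close> is a compact semigroup and so
  contains an idempotent. Distality forces an idempotent to be the identity on \<open>X\<close>, and
  membership in the ideal writes this identity as \<open>q\<close> after \<open>p\<close>.\<close>

lemma distal_Ellis_left_inverse:
  assumes compact: "compact_space top_X" and distal: distal and p: "p \<in> Ellis_semigroup"
  obtains q where "q \<in> Ellis_semigroup" "\<And>x. x \<in> X \<Longrightarrow> q (p x) = x"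
proof -
  let ?S = "(\<lambda>q. compose X q p) ` Ellis_semigroup"
  let ?T = "subtopology top_maps ?S"
  have pT: "p \<in> topspace top_maps" using p Ellis_semigroup_subset by blast
  have SE: "?S \<subseteq> Ellis_semigroup" using p Ellis_semigroup_compose by blast
  have top: "topspace ?T = ?S" using SE Ellis_semigroup_subset by (auto simp: topspace_subtopology)
  have maps: "u \<in> X \<rightarrow> X" if "u \<in> ?S" for u using SE that Ellis_semigroup_maps by blast
  have "compact_space top_maps" using compact by (simp add: compact_space_product_topology)
  then have compact_S: "compactin top_maps ?S"
    by (intro image_compactin[OF _ continuous_compose_left[OF pT]] closedin_compact_space closedin_Ellis_semigroup)
  have Hausdorff_maps: "Hausdorff_space top_maps" using Hausdorff by (simp add: Hausdorff_space_product_topology)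
  have closed: "compose X u v \<in> ?S" if "u \<in> ?S" "v \<in> ?S" for u v
  proof -
    obtain q where q: "q \<in> Ellis_semigroup" "v = compose X q p" using \<open>v \<in> ?S\<close> by blast
    have "compose X u v = compose X (compose X u q) p"
      using p q by (auto simp: compose_def Ellis_semigroup_maps)
    then show ?thesis using q that SE Ellis_semigroup_compose by blast
  qed
  have assoc: "compose X (compose X u v) w = compose X u (compose X v w)" if "w \<in> ?S" for u v w :: "'x \<Rightarrow> 'x"
    using maps[OF that] by (intro ext) (auto simp: compose_def Pi_iff)
  have continuous: "continuous_map ?T ?T (\<lambda>u. compose X u v)" if "v \<in> ?S" for v
  proof -
    have "continuous_map ?T top_maps (\<lambda>u. compose X u v)"
      using that SE Ellis_semigroup_subset by (intro continuous_map_from_subtopology continuous_compose_left) blast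
    then show ?thesis using closed that top by (auto simp: continuous_map_in_subtopology)
  qed
  obtain u where "u \<in> topspace ?T" "compose X u u = u"
  proof (rule Ellis_Numakura[of ?T "compose X"])
    show "compact_space ?T" using compact_S by (rule compact_space_subtopology)
    show "Hausdorff_space ?T" using Hausdorff_maps by (rule Hausdorff_space_subtopology)
    show "topspace ?T \<noteq> {}" using p unfolding top by blast
    show "compose X u v \<in> topspace ?T" if "u \<in> topspace ?T" "v \<in> topspace ?T" for u v
      using that unfolding top by (rule closed)
    show "compose X (compose X u v) w = compose X u (compose X v w)" if "w \<in> topspace ?T" for u v w :: "'x \<Rightarrow> 'x"
      using that unfolding top by (rule assoc)
    show "continuous_map ?T ?T (\<lambda>u. compose X u v)" if "v \<in> topspace ?T" for v
      using that unfolding top by (rule continuous)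
  qed
  then have u: "u \<in> ?S" "compose X u u = u" by (simp_all only: top)
  have uE: "u \<in> Ellis_semigroup" using u SE by blast
  have "u x = x" if x: "x \<in> X" for x
  proof (rule ccontr)
    \<comment> \<open>An idempotent sends both \<open>x\<close> and \<open>u x\<close> to
      \<open>u x\<close>, so the orbit closure of the pair \<open>(x, u x)\<close> meets the
      diagonal.\<close>
    assume "u x \<noteq> x"
    have ux: "u x \<in> X" using uE x by (rule Ellis_semigroup_maps)
    have "u (u x) = u x" using fun_cong[OF u(2), of x] x by (simp add: compose_def)
    then have "(u x, u x) \<in> prod_topology top_X top_X closure_of ((\<lambda>g. (act g x, act g (u x))) ` carrier G)"
      using Ellis_semigroup_orbit_closure[OF uE x ux] by simp
    moreover have "(u x, u x) \<in> Id_on X" using ux by blast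
    moreover have "prod_topology top_X top_X closure_of ((\<lambda>g. (act g x, act g (u x))) ` carrier G) \<inter> Id_on X = {}"
      using distal[unfolded distal_def, rule_format, OF x ux] \<open>u x \<noteq> x\<close> by simp
    ultimately show False by (simp add: disjoint_iff)
  qed
  moreover obtain q where "q \<in> Ellis_semigroup" "u = compose X q p" using u by blast
  ultimately show thesis using that by (metis compose_eq)
qed

end

section \<open>Translates of a clopen set\<close>

locale clopen_in_distal_flow = flow G T X \<U> act
  for G (structure) and T :: "'g topology" and X :: "'x set" and \<U> and act +
  fixes \<Gamma> :: "'g set" and U :: "'x set"
  assumes compact_X: "compact_space top_X"
    and distal: distal
    and compact_generators: "compactin T \<Gamma>"
    and one_generator: "\<one> \<in> \<Gamma>"
    and generators_inv: "\<Gamma> = set_inv \<Gamma>"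
    and generates: "carrier G = (\<Union>r\<in>{1..}. (((<#>) \<Gamma>) ^^ r) {\<one>})"
    and open_U: "openin top_X U"
    and closed_U: "closedin top_X U"
begin

section \<open>Balls for the word length given by \<open>\<Gamma>\<close>\<close>

definition word_ball :: "nat \<Rightarrow> 'g set" where
  "word_ball n = (((<#>) \<Gamma>) ^^ n) {\<one>}"

lemma generators_subset: "\<Gamma> \<subseteq> carrier G"
  using compactin_subset_topspace[OF compact_generators] by (simp add: topspace_group)

lemma word_ball_0: "word_ball 0 = {\<one>}"
  by (simp add: word_ball_def)

lemma word_ball_Suc: "word_ball (Suc n) = \<Gamma> <#> word_ball n"
  by (simp add: word_ball_def)

lemma word_ball_subset: "word_ball n \<subseteq> carrier G"
proof (induction n)
  case (Suc n)
  then show ?case unfolding word_ball_Suc by (intro set_mult_closed generators_subset)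
qed (simp add: word_ball_0)

lemma word_ball_add: "word_ball (m + n) = word_ball m <#> word_ball n"
proof (induction m)
  case 0
  have "{\<one>} <#> word_ball n = word_ball n"
    using word_ball_subset[of n] by (auto simp: set_mult_def subset_iff)
  then show ?case by (simp add: word_ball_0)
next
  case (Suc m)
  then show ?case
    using set_mult_assoc[OF generators_subset word_ball_subset word_ball_subset] by (simp add: word_ball_Suc)
qed

lemma word_ball_mult: "g \<otimes> h \<in> word_ball (m + n)" if "g \<in> word_ball m" "h \<in> word_ball n"
  using that by (auto simp: word_ball_add set_mult_def)

lemma word_ball_addE:
  assumes "g \<in> word_ball (m + n)"
  obtains h k where "h \<in> word_ball m" "k \<in> word_ball n" "g = h \<otimes> k"
  using assms by (auto simp: word_ball_add set_mult_def)

lemma one_in_word_ball: "\<one> \<in> word_ball n"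
proof (induction n)
  case (Suc n)
  then have "\<one> \<otimes> \<one> \<in> word_ball (Suc n)"
    unfolding word_ball_Suc using one_generator unfolding set_mult_def by blast
  then show ?case by simp
qed (simp add: word_ball_0)

lemma word_ball_mono:
  assumes "m \<le> n"
  shows "word_ball m \<subseteq> word_ball n"
proof
  fix g assume g: "g \<in> word_ball m"
  then have "g \<otimes> \<one> \<in> word_ball (m + (n - m))" using one_in_word_ball by (rule word_ball_mult)
  moreover have "g \<in> carrier G" using g word_ball_subset by blast
  ultimately show "g \<in> word_ball n" using assms by simp
qed

lemma word_ball_1: "word_ball (Suc 0) = \<Gamma>"
  using generators_subset by (auto simp: word_ball_Suc word_ball_0 set_mult_def subset_iff)

text \<open>Inversion reverses a word: the leading letter \<open>s\<close> becomes the trailing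
  letter \<open>inv s\<close>, whence the splitting \<open>n + Suc 0\<close>.\<close>

lemma word_ball_inv: "g \<in> word_ball n \<Longrightarrow> inv g \<in> word_ball n"
proof (induction n arbitrary: g)
  case (Suc n)
  then obtain s h where sh: "s \<in> \<Gamma>" "h \<in> word_ball n" "g = s \<otimes> h"
    by (auto simp: word_ball_Suc set_mult_def)
  have "inv s \<in> \<Gamma>" using sh(1) by (subst generators_inv) (auto simp: SET_INV_def)
  then have "inv h \<otimes> inv s \<in> word_ball (n + Suc 0)"
    using Suc.IH[OF sh(2)] by (intro word_ball_mult) (simp_all add: word_ball_1)
  moreover have "inv g = inv h \<otimes> inv s"
    using sh generators_subset word_ball_subset[of n] by (simp add: inv_mult_group subset_iff)
  ultimately show ?case by simp
qed (simp add: word_ball_0)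

lemma carrier_word_ball: "g \<in> carrier G \<Longrightarrow> \<exists>n. g \<in> word_ball n"
  using generates by (auto simp: word_ball_def)

lemma compact_word_ball: "compactin T (word_ball n)"
proof (induction n)
  case 0
  then show ?case by (simp add: word_ball_0 topspace_group)
next
  case (Suc n)
  have "compactin T ((\<lambda>(s, t). s \<otimes> t) ` (\<Gamma> \<times> word_ball n))"
    using compact_generators Suc by (intro image_compactin[OF _ continuous_mult]) (simp add: compactin_Times)
  moreover have "(\<lambda>(s, t). s \<otimes> t) ` (\<Gamma> \<times> word_ball n) = word_ball (Suc n)"
    by (auto simp: word_ball_Suc set_mult_def)
  ultimately show ?case by simp
qed

section \<open>The translates of \<open>U\<close> and their finiteness on word balls\<close>

definition hitting :: "'g \<Rightarrow> 'x set" where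
  "hitting g = {x \<in> X. act g x \<in> U}"

lemma open_hitting: "openin top_X (hitting g)" if "g \<in> carrier G"
  using openin_continuous_map_preimage[OF continuous_act_fixed[OF that] open_U]
  by (simp add: hitting_def topspace_X)

lemma closed_hitting: "closedin top_X (hitting g)" if "g \<in> carrier G"
  using closedin_continuous_map_preimage[OF continuous_act_fixed[OF that] closed_U]
  by (simp add: hitting_def topspace_X)

text \<open>As \<open>U\<close> is clopen, the pairs \<open>(h, x)\<close> for which
  \<open>act h x\<close> and \<open>act g x\<close> lie on the same side of \<open>U\<close> form an
  open set \<open>?W\<close> containing \<open>{g} \<times> X\<close>. Compactness of
  \<open>X\<close> and the tube lemma put some \<open>V \<times> X\<close> inside it.\<close>

lemma hitting_locally_constant:
  assumes "g \<in> carrier G"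
  obtains V where "openin T V" "g \<in> V" "\<And>h. h \<in> V \<Longrightarrow> hitting h = hitting g"
proof -
  let ?P = "prod_topology T top_X"
  let ?hit = "{z \<in> topspace ?P. (case z of (t, x) \<Rightarrow> act t x) \<in> U}"
  let ?miss = "{z \<in> topspace ?P. (case z of (t, x) \<Rightarrow> act t x) \<in> topspace top_X - U}"
  let ?W = "(?hit \<inter> carrier G \<times> hitting g) \<union> (?miss \<inter> carrier G \<times> (X - hitting g))"
  have "openin ?P ?hit" "openin ?P ?miss"
    using open_U closed_U by (blast intro: openin_continuous_map_preimage[OF continuous_act])+
  moreover have "openin ?P (carrier G \<times> hitting g)"
    using open_hitting[OF assms] openin_topspace[of T] by (simp add: openin_prod_Times_iff topspace_group)
  moreover have "openin ?P (carrier G \<times> (X - hitting g))"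
    using closed_hitting[OF assms] openin_topspace[of T]
    by (simp add: openin_prod_Times_iff topspace_group closedin_def topspace_X)
  ultimately have "openin ?P ?W" by (intro openin_Un openin_Int)
  moreover have "{g} \<times> X \<subseteq> ?W"
    using assms act_closed by (auto simp: topspace_group topspace_X hitting_def)
  moreover have "compactin top_X X" using compact_X by (simp add: compact_space_def topspace_X)
  moreover have "g \<in> topspace T" using assms by (simp add: topspace_group)
  ultimately obtain V V' where V: "openin T V" "g \<in> V" "X \<subseteq> V'" "V \<times> V' \<subseteq> ?W"
    using tube_lemma_right[of T top_X ?W X g] by blast
  have "hitting h = hitting g" if "h \<in> V" for h
  proof -
    have "(h, x) \<in> ?W" if "x \<in> X" for x using V that \<open>h \<in> V\<close> by blast
    then show ?thesis by (auto simp: hitting_def)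
  qed
  then show thesis using V that by blast
qed

text \<open>A locally constant function takes only finitely many values on a compact set.\<close>

lemma finite_hitting_word_ball: "finite (hitting ` word_ball n)"
proof -
  obtain V where V: "\<And>g. g \<in> carrier G \<Longrightarrow> openin T (V g) \<and> g \<in> V g \<and> (\<forall>h\<in>V g. hitting h = hitting g)"
  proof -
    have "\<exists>V. openin T V \<and> g \<in> V \<and> (\<forall>h\<in>V. hitting h = hitting g)" if "g \<in> carrier G" for g
      by (rule hitting_locally_constant[OF that]) blast
    then have "\<forall>g\<in>carrier G. \<exists>V. openin T V \<and> g \<in> V \<and> (\<forall>h\<in>V. hitting h = hitting g)" by blast
    from bchoice[OF this] show thesis using that by blast
  qed
  have "\<exists>\<F>. finite \<F> \<and> \<F> \<subseteq> V ` word_ball n \<and> word_ball n \<subseteq> \<Union>\<F>"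
    using V word_ball_subset by (intro compactinD[OF compact_word_ball]) blast+
  then obtain \<F> where \<F>: "finite \<F>" "\<F> \<subseteq> V ` word_ball n" "word_ball n \<subseteq> \<Union>\<F>" by blast
  obtain K where K: "K \<subseteq> word_ball n" "finite K" "\<F> = V ` K"
    using finite_subset_image[OF \<F>(1,2)] by blast
  have "hitting ` word_ball n \<subseteq> hitting ` K"
  proof clarify
    fix h assume "h \<in> word_ball n"
    then obtain g where "g \<in> K" "h \<in> V g" using K(3) \<F>(3) by blast
    moreover have "g \<in> carrier G" using \<open>g \<in> K\<close> K(1) word_ball_subset by blast
    ultimately have "hitting h = hitting g" using V by blast
    then show "hitting h \<in> hitting ` K" using \<open>g \<in> K\<close> by blast
  qed
  then show ?thesis using K(2) finite_surj by blast
qed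

section \<open>Agreement relations and their stabilisation\<close>

text \<open>The family is left arbitrary because two kinds occur: the translates over a word ball in
  \<open>agree\<close>, and the same translates pulled back along a fixed element in
  \<open>closedin_near\<close>.\<close>

definition agree_on :: "'x set set \<Rightarrow> ('x \<times> 'x) set" where
  "agree_on \<A> = {(x, y). x \<in> X \<and> y \<in> X \<and> (\<forall>V\<in>\<A>. x \<in> V \<longleftrightarrow> y \<in> V)}"

lemma closedin_agree_on:
  assumes "\<And>V. V \<in> \<A> \<Longrightarrow> openin top_X V \<and> closedin top_X V"
  shows "closedin (prod_topology top_X top_X) (agree_on \<A>)"
proof -
  let ?P = "prod_topology top_X top_X"
  have "closedin ?P (V \<times> V \<union> (X - V) \<times> (X - V))" if "V \<in> \<A>" for V
  proof -
    have "closedin top_X V" "closedin top_X (X - V)"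
      using assms[OF that] closedin_diff[OF closedin_topspace, of top_X V] by (simp_all add: topspace_X)
    then show ?thesis by (intro closedin_Un) (simp_all add: closedin_prod_Times_iff)
  qed
  \<comment> \<open>Inserting \<open>X \<times> X\<close> keeps the intersection inside the space
    when \<open>\<A>\<close> is empty.\<close>
  then have "closedin ?P (\<Inter> (insert (X \<times> X) ((\<lambda>V. V \<times> V \<union> (X - V) \<times> (X - V)) ` \<A>)))"
    using closedin_topspace[of top_X] by (intro closedin_Inter) (auto simp: topspace_X closedin_prod_Times_iff)
  moreover have "\<Inter> (insert (X \<times> X) ((\<lambda>V. V \<times> V \<union> (X - V) \<times> (X - V)) ` \<A>)) = agree_on \<A>"
    unfolding agree_on_def by auto
  ultimately show ?thesis by simp
qed

text \<open>This is the \<open>n\<close>-equivalence of the introduction.\<close>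

definition agree :: "nat \<Rightarrow> ('x \<times> 'x) set" where
  "agree n = agree_on (hitting ` word_ball n)"

lemma agree_iff:
  "(x, y) \<in> agree n \<longleftrightarrow> x \<in> X \<and> y \<in> X \<and> (\<forall>g\<in>word_ball n. act g x \<in> U \<longleftrightarrow> act g y \<in> U)"
  unfolding agree_def agree_on_def hitting_def by auto

lemma closedin_agree: "closedin (prod_topology top_X top_X) (agree n)"
  unfolding agree_def using open_hitting closed_hitting word_ball_subset
  by (intro closedin_agree_on) blast

lemma agree_antimono: "m \<le> n \<Longrightarrow> agree n \<subseteq> agree m"
  using word_ball_mono[of m n] by (simp add: agree_iff subset_iff)

text \<open>Testing with \<open>h\<close> after moving by \<open>g\<close> is testing with
  \<open>h \<otimes> g\<close>, so moving by a word of length \<open>n\<close> costs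
  \<open>n\<close> levels of agreement.\<close>

lemma agree_translate:
  assumes "(x, y) \<in> agree (m + n)" "g \<in> word_ball n"
  shows "(act g x, act g y) \<in> agree m"
proof -
  have xy: "x \<in> X" "y \<in> X" and g: "g \<in> carrier G" using assms word_ball_subset[of n] by (auto simp: agree_iff)
  have "act h (act g x) \<in> U \<longleftrightarrow> act h (act g y) \<in> U" if h: "h \<in> word_ball m" for h
  proof -
    have "h \<in> carrier G" using h word_ball_subset by blast
    then show ?thesis
      using assms(1) word_ball_mult[OF h assms(2)] xy g by (simp add: agree_iff act_mult flip: act_mult)
  qed
  then show ?thesis using xy g by (simp add: agree_iff act_closed)
qed

text \<open>The last letter \<open>s\<close> of a word acts first. By the assumption it sends a pair
  in \<open>agree n\<close> to another one, which by induction lies in \<open>agree (n + k)\<close>,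
  so the other \<open>n + k\<close> letters cannot separate it.\<close>

lemma agree_stable:
  assumes "agree n \<subseteq> agree (Suc n)"
  shows "agree n \<subseteq> agree (n + k)"
proof (induction k)
  case (Suc k)
  show ?case
  proof clarify
    fix x y assume xy: "(x, y) \<in> agree n"
    then have X: "x \<in> X" "y \<in> X" by (auto simp: agree_iff)
    have "act g x \<in> U \<longleftrightarrow> act g y \<in> U" if g: "g \<in> word_ball ((n + k) + Suc 0)" for g
    proof -
      obtain h s where hs: "h \<in> word_ball (n + k)" "s \<in> word_ball (Suc 0)" "g = h \<otimes> s"
        using g by (rule word_ball_addE)
      have "(x, y) \<in> agree (n + Suc 0)" using xy assms by auto
      then have "(act s x, act s y) \<in> agree (n + k)" using agree_translate[OF _ hs(2)] Suc.IH by blast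
      then have "act h (act s x) \<in> U \<longleftrightarrow> act h (act s y) \<in> U" using hs(1) by (simp add: agree_iff)
      moreover have "h \<in> carrier G" "s \<in> carrier G" using hs word_ball_subset by blast+
      ultimately show ?thesis using hs(3) X by (simp add: act_mult)
    qed
    then show "(x, y) \<in> agree (n + Suc k)" using X by (simp add: agree_iff)
  qed
qed simp

text \<open>This is where distality enters. Compactness replaces the elements \<open>h\<close>,
  which depend on \<open>n\<close>, by one \<open>p\<close> serving all levels, and a left inverse
  of \<open>p\<close> returns to \<open>(a, b)\<close>.\<close>

lemma near_pair_not_separated:
  assumes ab: "a \<in> X" "b \<in> X"
    and near: "\<And>n. \<exists>h\<in>carrier G. (act h a, act h b) \<in> agree n"
  shows "a \<in> U \<longleftrightarrow> b \<in> U"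
proof -
  define F where "F n = Ellis_semigroup \<inter> {p \<in> topspace top_maps. (p a, p b) \<in> agree n}" for n
  have "(\<Inter>n. F n) \<noteq> {}"
  proof (rule compact_space_imp_nest)
    show "compact_space top_maps" using compact_X by (simp add: compact_space_product_topology)
    show "closedin top_maps (F n)" for n
      unfolding F_def
      by (intro closedin_Int closedin_Ellis_semigroup closedin_continuous_map_preimage[OF continuous_eval_pair[OF ab] closedin_agree])
    show "F n \<noteq> {}" for n
    proof -
      obtain h where h: "h \<in> carrier G" "(act h a, act h b) \<in> agree n" using near by blast
      have "restrict (act h) X \<in> F n"
        using h ab translation_in_Ellis[OF h(1)] subsetD[OF Ellis_semigroup_subset translation_in_Ellis[OF h(1)]]
        unfolding F_def by simp
      then show ?thesis by blast
    qed
    show "decseq F" unfolding F_def by (rule antimonoI) (use agree_antimono in blast)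
  qed
  then obtain p where p: "p \<in> Ellis_semigroup" "\<And>n. (p a, p b) \<in> agree n" unfolding F_def by blast
  obtain q where q: "q \<in> Ellis_semigroup" "\<And>x. x \<in> X \<Longrightarrow> q (p x) = x"
    using distal_Ellis_left_inverse[OF compact_X distal p(1)] by blast
  have pX: "p a \<in> X" "p b \<in> X" using p(1) ab by (auto intro: Ellis_semigroup_maps)
  \<comment> \<open>An element of length \<open>n\<close> uses up \<open>n\<close> levels of
    agreement and leaves level \<open>0\<close>. Agreement at all levels thus places the whole orbit
    in the closed set \<open>agree 0\<close>, and with it the image under the limit
    \<open>q\<close>.\<close>
  have "(\<lambda>g. (act g (p a), act g (p b))) ` carrier G \<subseteq> agree 0"
  proof clarify
    fix g assume g: "g \<in> carrier G"
    then obtain n where "g \<in> word_ball n" using carrier_word_ball by blast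
    then show "(act g (p a), act g (p b)) \<in> agree 0" using agree_translate[of "p a" "p b" 0 n] p(2) by simp
  qed
  then have "(q (p a), q (p b)) \<in> agree 0"
    using Ellis_semigroup_orbit_closure[OF q(1) pX] closure_of_minimal[OF _ closedin_agree] by blast
  then show ?thesis using q(2) ab by (simp add: agree_iff word_ball_0 act_one)
qed

text \<open>Although \<open>h\<close> may range over an infinite set, it enters only through the
  sets \<open>hitting (g \<otimes> h)\<close>, which are among the finitely many translates over the
  ball of radius \<open>n + m\<close>. The set is therefore a finite union of closed sets.\<close>

lemma closedin_near:
  "closedin (prod_topology top_X top_X)
     {(a, b). a \<in> X \<and> b \<in> X \<and> (\<exists>h\<in>word_ball m. (act h a, act h b) \<in> agree n)}" (is "closedin ?P ?D")
proof -
  let ?\<A> = "\<lambda>h. (\<lambda>g. hitting (g \<otimes> h)) ` word_ball n"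
  have "?\<A> ` word_ball m \<subseteq> Pow (hitting ` word_ball (n + m))"
    using word_ball_mult by blast
  then have "finite (agree_on ` ?\<A> ` word_ball m)"
    using finite_hitting_word_ball by (meson finite_Pow_iff finite_imageI finite_subset)
  moreover have "closedin ?P (agree_on (?\<A> h))" if "h \<in> word_ball m" for h
  proof (rule closedin_agree_on)
    fix V assume "V \<in> ?\<A> h"
    then obtain g where g: "g \<in> word_ball n" "V = hitting (g \<otimes> h)" by blast
    then have "g \<otimes> h \<in> carrier G" using that word_ball_subset by blast
    then show "openin top_X V \<and> closedin top_X V" using g open_hitting closed_hitting by blast
  qed
  ultimately have "closedin ?P (\<Union> (agree_on ` ?\<A> ` word_ball m))"
    by (intro closedin_Union) blast+
  moreover have "agree_on (?\<A> h) = {(a, b). a \<in> X \<and> b \<in> X \<and> (act h a, act h b) \<in> agree n}"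
    if "h \<in> word_ball m" for h
  proof -
    have "h \<in> carrier G" using that word_ball_subset by blast
    moreover have "g \<in> carrier G" if "g \<in> word_ball n" for g using that word_ball_subset by blast
    ultimately show ?thesis
      by (auto simp: agree_on_def agree_iff hitting_def act_mult act_closed)
  qed
  then have "\<Union> (agree_on ` ?\<A> ` word_ball m) = ?D" by auto
  ultimately show ?thesis by simp
qed

lemma agree_stabilizes: "\<exists>n. agree n \<subseteq> agree (Suc n)"
proof (rule ccontr)
  let ?P = "prod_topology top_X top_X"
  \<comment> \<open>The bound \<open>Suc j\<close> on the length of \<open>h\<close> makes the
    condition closed, so it survives in the limit pair.\<close>
  let ?near = "\<lambda>j. {(a, b). a \<in> X \<and> b \<in> X \<and> (\<exists>h\<in>word_ball (Suc j). (act h a, act h b) \<in> agree j)}"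
  define C where "C n = (U \<times> (X - U) \<union> (X - U) \<times> U) \<inter> (\<Inter>j\<in>{..n}. ?near j)" for n
  assume "\<not> ?thesis"
  then have unstable: "\<not> agree n \<subseteq> agree (Suc n)" for n by blast
  have "(\<Inter>n. C n) \<noteq> {}"
  proof (rule compact_space_imp_nest)
    show "compact_space ?P" using compact_X by (simp add: compact_space_prod_topology)
    show "closedin ?P (C n)" for n
    proof -
      have "closedin top_X (X - U)" using open_U closedin_diff[OF closedin_topspace] by (metis topspace_X)
      then have "closedin ?P (U \<times> (X - U) \<union> (X - U) \<times> U)"
        using closed_U by (intro closedin_Un) (simp_all add: closedin_prod_Times_iff)
      then show ?thesis unfolding C_def by (intro closedin_Int closedin_INT closedin_near) auto
    qed
    show "C n \<noteq> {}" for n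
    proof -
      obtain x y where xy: "(x, y) \<in> agree (Suc n)" "(x, y) \<notin> agree (Suc (Suc n))"
        using unstable[of "Suc n"] by auto
      have X: "x \<in> X" "y \<in> X" using xy by (auto simp: agree_iff)
      obtain g where g: "g \<in> word_ball (Suc (Suc n))" "\<not> (act g x \<in> U \<longleftrightarrow> act g y \<in> U)"
        using xy X by (auto simp: agree_iff)
      have gG: "g \<in> carrier G" using g word_ball_subset by blast
      have "(act g x, act g y) \<in> ?near j" if "j \<le> n" for j
      proof -
        \<comment> \<open>Cutting off a prefix \<open>s\<close> of length \<open>j + 1\<close>
          leaves a tail \<open>t\<close> of length \<open>n + 1 - j\<close>, which turns agreement
          at level \<open>n + 1\<close> into agreement at level \<open>j\<close>. Applying
          \<open>inv s\<close> to the separated pair recovers the pair moved by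
          \<open>t\<close>.\<close>
        have "g \<in> word_ball (Suc j + (Suc n - j))" using g that by simp
        then obtain s t where st: "s \<in> word_ball (Suc j)" "t \<in> word_ball (Suc n - j)" "g = s \<otimes> t"
          by (rule word_ball_addE)
        have G: "s \<in> carrier G" "t \<in> carrier G" using st word_ball_subset by blast+
        have "(x, y) \<in> agree (j + (Suc n - j))" using xy that by simp
        then have "(act t x, act t y) \<in> agree j" using st(2) by (rule agree_translate)
        then have "(act (inv s) (act g x), act (inv s) (act g y)) \<in> agree j"
          using G X st(3) by (simp add: act_mult act_inv act_closed)
        then show ?thesis using word_ball_inv[OF st(1)] X gG act_closed by blast
      qed
      then have "(act g x, act g y) \<in> C n" using g(2) X gG act_closed unfolding C_def by auto
      then show ?thesis by blast
    qed
    show "decseq C" unfolding C_def by (rule antimonoI) force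
  qed
  then obtain a b where "(a, b) \<in> (\<Inter>n. C n)" by auto
  then have ab: "(a, b) \<in> C n" for n by blast
  have X: "a \<in> X" "b \<in> X" and sep: "\<not> (a \<in> U \<longleftrightarrow> b \<in> U)"
    using ab[of 0] closedin_subset[OF closed_U] by (auto simp: C_def topspace_X)
  have "\<exists>h\<in>carrier G. (act h a, act h b) \<in> agree n" for n
  proof -
    have "\<exists>h\<in>word_ball (Suc n). (act h a, act h b) \<in> agree n" using ab[of n] by (simp add: C_def)
    then show ?thesis using word_ball_subset by blast
  qed
  then show False using near_pair_not_separated[OF X] sep by blast
qed

text \<open>The relation is \<open>agree n\<close> at a level where it is stable: agreement there
  implies agreement at every level, and translation only lowers the level.\<close>

lemma finite_clopen_invariant_equivalence:
  obtains R where "equiv X R" "finite (X // R)"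
    "\<And>x. x \<in> X \<Longrightarrow> openin top_X (R `` {x})"
    "\<And>g x y. \<lbrakk>g \<in> carrier G; (x, y) \<in> R\<rbrakk> \<Longrightarrow> (act g x, act g y) \<in> R"
    "\<And>x y. (x, y) \<in> R \<Longrightarrow> x \<in> U \<longleftrightarrow> y \<in> U"
proof -
  obtain n where n: "agree n \<subseteq> agree (Suc n)" using agree_stabilizes by blast
  let ?R = "agree n" and ?\<A> = "hitting ` word_ball n"
  have fin: "finite ?\<A>" by (rule finite_hitting_word_ball)
  have equiv: "equiv X ?R"
    by (rule equivI) (auto simp: refl_on_def sym_def trans_def agree_iff)
  \<comment> \<open>A class is cut out by finitely many clopen translates, each taken or
    complemented. This gives openness, and it codes a class by the subfamily of translates that
    contain it.\<close>
  have class_eq: "?R `` {x} = X \<inter> (\<Inter>V\<in>?\<A>. if x \<in> V then V else X - V)" if "x \<in> X" for x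
    using that by (auto simp: agree_def agree_on_def split: if_splits)
  have finite: "finite (X // ?R)"
  proof (rule finite_surj)
    show "finite (Pow ?\<A>)" using fin by simp
    show "X // ?R \<subseteq> (\<lambda>\<B>. X \<inter> (\<Inter>V\<in>?\<A>. if V \<in> \<B> then V else X - V)) ` Pow ?\<A>"
    proof
      fix c assume "c \<in> X // ?R"
      then obtain x where x: "x \<in> X" "c = ?R `` {x}" by (rule quotientE)
      show "c \<in> (\<lambda>\<B>. X \<inter> (\<Inter>V\<in>?\<A>. if V \<in> \<B> then V else X - V)) ` Pow ?\<A>"
      proof (rule image_eqI)
        show "{V \<in> ?\<A>. x \<in> V} \<in> Pow ?\<A>" by blast
        show "c = X \<inter> (\<Inter>V\<in>?\<A>. if V \<in> {V \<in> ?\<A>. x \<in> V} then V else X - V)"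
          unfolding x(2) class_eq[OF x(1)] by (intro arg_cong2[where f="(\<inter>)"] INF_cong) auto
      qed
    qed
  qed
  have classes_open: "openin top_X (?R `` {x})" if "x \<in> X" for x
  proof -
    have "openin top_X (if x \<in> V then V else X - V)" if V: "V \<in> ?\<A>" for V
    proof -
      obtain g where "g \<in> carrier G" "V = hitting g" using V word_ball_subset by blast
      then show ?thesis using open_hitting[of g] closed_hitting[of g] by (simp add: closedin_def topspace_X)
    qed
    moreover have "?\<A> \<noteq> {}" using one_in_word_ball by blast
    ultimately have "openin top_X (\<Inter>V\<in>?\<A>. if x \<in> V then V else X - V)"
      using fin by (intro openin_INT2) auto
    then show ?thesis
      unfolding class_eq[OF that] using openin_topspace[of top_X] by (intro openin_Int) (simp_all add: topspace_X)
  qed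
  have invariant: "(act g x, act g y) \<in> ?R" if "g \<in> carrier G" "(x, y) \<in> ?R" for g x y
  proof -
    obtain k where k: "g \<in> word_ball k" using carrier_word_ball \<open>g \<in> carrier G\<close> by blast
    have "(x, y) \<in> agree (n + k)" using agree_stable[OF n] that by blast
    then show ?thesis using k by (rule agree_translate)
  qed
  have separates: "x \<in> U \<longleftrightarrow> y \<in> U" if "(x, y) \<in> ?R" for x y
    using that one_in_word_ball[of n] act_one unfolding agree_iff by metis
  show thesis using that[OF equiv finite classes_open invariant separates] .
qed

end

section \<open>Finite factors\<close>

lemma is_uniformity_discrete: "is_uniformity Y {\<alpha>. Id_on Y \<subseteq> \<alpha> \<and> \<alpha> \<subseteq> Y \<times> Y}"
proof -
  have "Id_on Y O Id_on Y \<subseteq> \<alpha>" if "Id_on Y \<subseteq> \<alpha>" for \<alpha> using that by auto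
  then show ?thesis unfolding is_uniformity_def by (safe; (blast | fastforce))
qed

lemma unif_topology_discrete:
  "unif_topology Y {\<alpha>. Id_on Y \<subseteq> \<alpha> \<and> \<alpha> \<subseteq> Y \<times> Y} = discrete_topology Y"
proof -
  have "\<exists>\<alpha>\<in>{\<alpha>. Id_on Y \<subseteq> \<alpha> \<and> \<alpha> \<subseteq> Y \<times> Y}. \<alpha> `` {x} \<subseteq> S" if "S \<subseteq> Y" "x \<in> S" for S x
    using that by (intro bexI[of _ "Id_on Y"]) auto
  then show ?thesis
    by (simp add: topology_eq openin_unif_topology[OF is_uniformity_discrete]) blast
qed

text \<open>Points of \<open>Y\<close> are open, so the preimage of a set is a union of open slices,
  one for each \<open>y\<close>.\<close>

lemma (in para_topological_group) continuous_into_discrete: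
  assumes Y: "finite Y" and cont: "\<And>y. y \<in> Y \<Longrightarrow> continuous_map T (discrete_topology Y) (\<lambda>t. f t y)"
  shows "continuous_map (prod_topology T (discrete_topology Y)) (discrete_topology Y) (\<lambda>(t, y). f t y)"
proof -
  have maps: "f t y \<in> Y" if "t \<in> carrier G" "y \<in> Y" for t y
    using funcset_mem[OF continuous_map_funspace[OF cont[OF that(2)]]] that(1) by (simp add: topspace_group)
  have "openin (prod_topology T (discrete_topology Y))
      {z \<in> topspace (prod_topology T (discrete_topology Y)). (case z of (t, y) \<Rightarrow> f t y) \<in> S}"
    if S: "S \<subseteq> Y" for S
  proof -
    have "openin (prod_topology T (discrete_topology Y)) ({t \<in> topspace T. f t y \<in> S} \<times> {y})" if "y \<in> Y" for y
      using that openin_continuous_map_preimage[OF cont[OF that], of S] S by (simp add: openin_prod_Times_iff)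
    then have "openin (prod_topology T (discrete_topology Y)) (\<Union>y\<in>Y. {t \<in> topspace T. f t y \<in> S} \<times> {y})"
      by blast
    moreover have "(\<Union>y\<in>Y. {t \<in> topspace T. f t y \<in> S} \<times> {y}) =
        {z \<in> topspace (prod_topology T (discrete_topology Y)). (case z of (t, y) \<Rightarrow> f t y) \<in> S}"
      by auto
    ultimately show ?thesis by simp
  qed
  then show ?thesis using maps by (auto simp: continuous_map_def topspace_group)
qed

section \<open>The quotient by an invariant equivalence relation with finitely many open
  classes\<close>

context flow
begin

text \<open>The group permutes the finitely many classes. Joint continuity reduces to orbit maps,
  which factor through the quotient map, and the kernel of the permutation action witnesses regular
  almost periodicity.\<close>

lemma finite_factor:
  fixes R :: "('x \<times> 'x) set"
  defines "Y \<equiv> X // R" and "\<V> \<equiv> {\<alpha>. Id_on (X // R) \<subseteq> \<alpha> \<and> \<alpha> \<subseteq> (X // R) \<times> (X // R)}"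
  assumes equiv: "equiv X R" and finite: "finite Y"
    and classes_open: "\<And>x. x \<in> X \<Longrightarrow> openin top_X (R `` {x})"
    and invariant: "\<And>g x y. \<lbrakk>g \<in> carrier G; (x, y) \<in> R\<rbrakk> \<Longrightarrow> (act g x, act g y) \<in> R"
  shows finite_factor_flow: "flow_factor G T X \<U> act Y \<V> (\<lambda>g y. act g ` y) (\<lambda>x. R `` {x})"
    and finite_factor_regularly_almost_periodic: "flow.regularly_almost_periodic G T Y \<V> (\<lambda>g y. act g ` y)"
proof -
  let ?act = "\<lambda>g y. act g ` y"
  have top_Y: "unif_topology Y \<V> = discrete_topology Y"
    unfolding Y_def \<V>_def by (rule unif_topology_discrete)
  have RX: "R \<subseteq> X \<times> X" using equiv by (rule equiv_type)
  \<comment> \<open>Invariance gives one inclusion and, applied to \<open>inv g\<close>, the other,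
    so images of classes are whole classes.\<close>
  have act_class: "act g ` (R `` {x}) = R `` {act g x}" if g: "g \<in> carrier G" and x: "x \<in> X" for g x
  proof
    show "act g ` (R `` {x}) \<subseteq> R `` {act g x}" using invariant[OF g] by blast
    show "R `` {act g x} \<subseteq> act g ` (R `` {x})"
    proof
      fix z assume "z \<in> R `` {act g x}"
      then have z: "(act g x, z) \<in> R" by blast
      then have "(act (inv g) (act g x), act (inv g) z) \<in> R" using g by (intro invariant) auto
      then have "act (inv g) z \<in> R `` {x}" using g x by (simp add: act_inv)
      moreover have "z = act g (act (inv g) z)" using g z RX by (subst act_inv(2)) auto
      ultimately show "z \<in> act g ` (R `` {x})" by blast
    qed
  qed
  have classE: "\<exists>x\<in>X. y = R `` {x}" if "y \<in> Y" for y using that unfolding Y_def quotient_def by blast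
  have classI: "R `` {x} \<in> Y" if "x \<in> X" for x using that unfolding Y_def by (rule quotientI)
  have class_map: "continuous_map top_X (discrete_topology Y) (\<lambda>x. R `` {x})"
  proof (subst continuous_map_def, intro conjI allI impI funcsetI)
    show "R `` {x} \<in> topspace (discrete_topology Y)" if "x \<in> topspace top_X" for x
      using that classI by (simp add: topspace_X)
    fix S assume "openin (discrete_topology Y) S"
    show "openin top_X {x \<in> topspace top_X. R `` {x} \<in> S}"
    proof (subst openin_subopen, clarify)
      fix x assume x: "x \<in> topspace top_X" "R `` {x} \<in> S"
      then have X: "x \<in> X" by (simp add: topspace_X)
      have "R `` {x} \<subseteq> {x \<in> topspace top_X. R `` {x} \<in> S}"
        using x(2) RX equiv_class_eq[OF equiv] by (auto simp: topspace_X)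
      then show "\<exists>N. openin top_X N \<and> x \<in> N \<and> N \<subseteq> {x \<in> topspace top_X. R `` {x} \<in> S}"
        using classes_open[OF X] equiv_class_self[OF equiv X] by blast
    qed
  qed
  have act_one_Y: "?act \<one> y = y" if "y \<in> Y" for y
    using classE[OF that] act_class[OF one_closed] act_one by auto
  have act_mult_Y: "?act (s \<otimes> t) y = ?act s (?act t y)"
    if st: "s \<in> carrier G" "t \<in> carrier G" and y: "y \<in> Y" for s t y
  proof -
    obtain x where "x \<in> X" "y = R `` {x}" using classE[OF y] by blast
    then show ?thesis using st by (simp add: act_class act_closed act_mult del: image_image)
  qed
  have act_closed_Y: "?act g y \<in> Y" if "g \<in> carrier G" "y \<in> Y" for g y
    using classE[OF that(2)] that(1) by (auto simp: act_class act_closed classI)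
  have orbit: "continuous_map T (discrete_topology Y) (\<lambda>g. ?act g y)" if "y \<in> Y" for y
  proof -
    obtain x where x: "x \<in> X" "y = R `` {x}" using classE[OF \<open>y \<in> Y\<close>] by blast
    show ?thesis
    proof (rule continuous_map_eq)
      show "continuous_map T (discrete_topology Y) ((\<lambda>x. R `` {x}) \<circ> (\<lambda>g. act g x))"
        by (rule continuous_map_compose[OF continuous_orbit_map[OF x(1)] class_map])
    qed (use x in \<open>simp add: act_class topspace_group\<close>)
  qed
  interpret Y: flow G T Y \<V> ?act
  proof unfold_locales
    show "is_uniformity Y \<V>" unfolding Y_def \<V>_def by (rule is_uniformity_discrete)
    show "Hausdorff_space (unif_topology Y \<V>)" by (simp add: top_Y)
    show "locally_compact_space (unif_topology Y \<V>)"
      using finite by (simp add: top_Y compact_imp_locally_compact_space compact_space_discrete_topology)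
    show "continuous_map (prod_topology T (unif_topology Y \<V>)) (unif_topology Y \<V>) (\<lambda>(t, y). ?act t y)"
      unfolding top_Y by (rule continuous_into_discrete[OF finite orbit])
    show "compactin (unif_topology Y \<V>) (unif_topology Y \<V> closure_of ((\<lambda>g. ?act g y) ` carrier G))" for y
      unfolding top_Y using finite by (intro finite_imp_compactin closure_of_subset_topspace)
        (simp_all add: discrete_topology_closure_of)
    show "?act \<one> y = y" if "y \<in> Y" for y using that by (rule act_one_Y)
    show "?act (s \<otimes> t) y = ?act s (?act t y)" if "s \<in> carrier G" "t \<in> carrier G" "y \<in> Y" for s t y
      using that by (rule act_mult_Y)
  qed
  show "flow_factor G T X \<U> act Y \<V> ?act (\<lambda>x. R `` {x})"
  proof unfold_locales
    show "continuous_map top_X (unif_topology Y \<V>) (\<lambda>x. R `` {x})" unfolding top_Y by (rule class_map)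
    show "(\<lambda>x. R `` {x}) ` X = Y" using classI classE by blast
  qed (simp add: act_class)

  \<comment> \<open>The kernel of the permutation action on the classes.\<close>
  define A where "A = {a \<in> carrier G. \<forall>y\<in>Y. ?act a y = y}"
  have act_inv_Y: "?act (inv g) (?act g y) = y" "?act g (?act (inv g) y) = y" if "g \<in> carrier G" "y \<in> Y" for g y
    using that by (simp_all add: act_one_Y del: image_image flip: act_mult_Y)
  have subgroup: "subgroup A G"
  proof (rule subgroupI)
    show "A \<noteq> {}" using act_one_Y unfolding A_def by blast
    show "inv a \<in> A" if "a \<in> A" for a
      using that act_inv_Y(1)[of a] unfolding A_def by force
    show "a \<otimes> b \<in> A" if "a \<in> A" "b \<in> A" for a b
      using that act_mult_Y unfolding A_def by auto
  qed (auto simp: A_def)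
  have "A \<lhd> G"
  proof (subst normal_inv_iff, intro conjI ballI)
    fix g a assume g: "g \<in> carrier G" and a: "a \<in> A"
    have "?act (g \<otimes> a \<otimes> inv g) y = y" if y: "y \<in> Y" for y
    proof -
      have "?act (g \<otimes> a \<otimes> inv g) y = ?act g (?act a (?act (inv g) y))"
        using g a y unfolding A_def by (simp add: act_mult_Y act_closed_Y del: image_image)
      also have "\<dots> = y" using a act_closed_Y[of "inv g" y] g y act_inv_Y(2)[OF g y] unfolding A_def by simp
      finally show ?thesis .
    qed
    then show "g \<otimes> a \<otimes> inv g \<in> A" using g a unfolding A_def by simp
  qed (rule subgroup)
  moreover have "syndetic A"
  proof -
    let ?perm = "\<lambda>g. restrict (?act g) Y"
    have "?perm ` carrier G \<subseteq> Y \<rightarrow>\<^sub>E Y" using act_closed_Y by auto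
    moreover have "finite (Y \<rightarrow>\<^sub>E Y)" using finite by (simp add: finite_PiE)
    ultimately have "finite (?perm ` carrier G)" by (rule finite_subset)
    \<comment> \<open>\<open>K\<close> represents each of the finitely many permutations induced by
      \<open>G\<close>; being finite, it is compact.\<close>
    from finite_subset_image[OF this subset_refl]
    obtain K where K: "finite K" "K \<subseteq> carrier G" "?perm ` carrier G = ?perm ` K" by blast
    have "carrier G \<subseteq> set_inv K <#> A"
    proof
      fix g assume g: "g \<in> carrier G"
      \<comment> \<open>Representing the permutation of \<open>inv g\<close> rather than that of
        \<open>g\<close> makes \<open>k \<otimes> g\<close> act trivially, which puts
        \<open>g\<close> in the product of \<open>set_inv K\<close> and \<open>A\<close>.\<close>
      then have "?perm (inv g) \<in> ?perm ` K" using K(3) by blast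
      then obtain k where k: "k \<in> K" "?perm (inv g) = ?perm k" by blast
      have kG: "k \<in> carrier G" using k K by blast
      have "?act (k \<otimes> g) y = y" if y: "y \<in> Y" for y
      proof -
        have "?act (k \<otimes> g) y = ?act k (?act g y)" using kG g y by (rule act_mult_Y)
        also have "\<dots> = ?act (inv g) (?act g y)"
          using fun_cong[OF k(2), of "?act g y"] act_closed_Y[OF g y] by simp
        also have "\<dots> = y" using g y by (rule act_inv_Y)
        finally show ?thesis .
      qed
      then have "k \<otimes> g \<in> A" using kG g unfolding A_def by simp
      moreover have "g = inv k \<otimes> (k \<otimes> g)" using kG g by (simp add: inv_solve_left)
      moreover have "inv k \<in> set_inv K" using k(1) by (auto simp: SET_INV_def)
      ultimately show "g \<in> set_inv K <#> A" unfolding set_mult_def by blast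
    qed
    moreover have "set_inv K <#> A \<subseteq> carrier G"
      using K by (intro set_mult_closed) (auto simp: SET_INV_def A_def)
    moreover have "compactin T K" using K by (simp add: finite_imp_compactin topspace_group)
    ultimately show ?thesis unfolding syndetic_def A_def by blast
  qed
  \<comment> \<open>Every entourage contains the diagonal, so the same kernel serves all
    \<open>\<alpha>\<close>.\<close>
  moreover have "(\<lambda>a. ?act a y) ` A \<subseteq> \<alpha> `` {y}" if "\<alpha> \<in> \<V>" "y \<in> Y" for \<alpha> y
    using that unfolding A_def \<V>_def Y_def by auto
  ultimately show "Y.regularly_almost_periodic"
    unfolding Y.regularly_almost_periodic_def by blast
qed

end

section \<open>From a disconnection of \<open>X\<close> to the factor\<close>

theorem mainTheorem10:
  fixes G :: "('g, 'm) monoid_scheme" and T :: "'g topology"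
    and X :: "'x set" and \<U> :: "('x \<times> 'x) set set" and act :: "'g \<Rightarrow> 'x \<Rightarrow> 'x"
  assumes "flow G T X \<U> act"
    and "flow.minimal G X \<U> act"
    and "flow.distal G X \<U> act"
    and "para_topological_group.compactly_generated G T"
    and "\<not> connected_space (unif_topology X \<U>)"
  shows "\<exists>(Y :: 'x set set) \<V> act' \<phi>.
           flow_factor G T X \<U> act Y \<V> act' \<phi> \<and>
           \<not> is_singleton Y \<and>
           flow.regularly_almost_periodic G T Y \<V> act'"
proof -
  interpret flow G T X \<U> act by fact
  obtain U where U: "openin top_X U" "closedin top_X U" "U \<noteq> {}" "U \<noteq> X"
    using assms(5) by (auto simp: connected_space_clopen_in topspace_X)
  obtain a b where ab: "a \<in> U" "b \<in> X" "b \<notin> U" "a \<in> X"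
    using U openin_subset[OF U(1)] by (auto simp: topspace_X)
  \<comment> \<open>By minimality \<open>X\<close> is itself an orbit closure, hence
    compact.\<close>
  have "top_X closure_of ((\<lambda>g. act g a) ` carrier G) = X"
    using assms(2) ab unfolding minimal_def by blast
  then have "compact_space top_X"
    using compact_orbit_closure[OF \<open>a \<in> X\<close>] by (simp add: compact_space_def topspace_X)
  moreover obtain \<Gamma> where "compactin T \<Gamma>" "\<one>\<^bsub>G\<^esub> \<in> \<Gamma>" "\<Gamma> = set_inv\<^bsub>G\<^esub> \<Gamma>"
      "carrier G = (\<Union>r\<in>{1..}. (set_mult G \<Gamma> ^^ r) {\<one>\<^bsub>G\<^esub>})"
    using assms(4) unfolding compactly_generated_def by blast
  ultimately interpret clopen_in_distal_flow G T X \<U> act \<Gamma> U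
    using assms(3) U by unfold_locales
  obtain R where R: "equiv X R" "finite (X // R)"
      "\<And>x. x \<in> X \<Longrightarrow> openin top_X (R `` {x})"
      "\<And>g x y. \<lbrakk>g \<in> carrier G; (x, y) \<in> R\<rbrakk> \<Longrightarrow> (act g x, act g y) \<in> R"
      "\<And>x y. (x, y) \<in> R \<Longrightarrow> x \<in> U \<longleftrightarrow> y \<in> U"
    using finite_clopen_invariant_equivalence by blast
  \<comment> \<open>\<open>R\<close> never relates a point of \<open>U\<close> to a point outside
    \<open>U\<close>, so \<open>a\<close> and \<open>b\<close> give two distinct points of the
    factor.\<close>
  have "R `` {a} \<noteq> R `` {b}" using ab R(5) eq_equiv_class[OF _ R(1) ab(2), of a] by blast
  moreover have "R `` {a} \<in> X // R" "R `` {b} \<in> X // R" using ab by (simp_all add: quotientI)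
  ultimately have nontrivial: "\<not> is_singleton (X // R)" by (auto simp: is_singleton_def)
  show ?thesis
    using finite_factor_flow[OF R(1-4)] nontrivial finite_factor_regularly_almost_periodic[OF R(1-4)]
    by (intro exI conjI)
qed

end
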